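(* Let $\ell\in\mathcal A_h$. The following hold. (i) $\mathcal A_h\subset\mathcal A$, and $$\mathbb E\Big[\sup_{s\in[0,t]}\|\ell\|_s^{\mathcal A}\Big]\le\|\ell\|_t^{\mathcal A_h},\qquad t\le T.$$ (ii) $$\mathbb E\Big[\sup_{s\in[0,t]}\langle\ell,\widehat{\mathbb W}_s\rangle^2\Big]\le\big(\|\ell\|_t^{\mathcal A_h}\big)^2,\qquad t\le T.$$ (iii) $t\mapsto\langle\ell,\widehat{\mathbb W}_t\rangle$ is (almost surely) continuous on $[0,T]$, and $$\mathbb E\Big[\sup_{t\in[0,T]}\big|\langle\ell,\widehat{\mathbb W}_t^{\le M}\rangle-\langle\ell,\widehat{\mathbb W}_t\rangle\big|\Big]\le\sum_{n=M}^\infty\sum_{v\in V_n}|\ell^v|\,h_T(v),\qquad M\in\mathbb N.$$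
   Context: Let $d\ge2$, $T>0$, and let $W=(W^2,\dots,W^d)$ be a $(d-1)$-dimensional Brownian motion on a complete filtered probability space satisfying the usual conditions; $\widehat W_t=(t,W_t^2,\dots,W_t^d)$. $V_n$ is the set of words of length $n$ in the letters $\mathbf 1,\dots,\mathbf d$, $V_0=\{\emptyset\}$, $V=\bigcup_nV_n$. $T((\mathbb R^d))$ is the space of formal series $\ell=\sum_{n\ge0}\sum_{v\in V_n}\ell^vv$, $\ell^v\in\mathbb R$. The signature is $\widehat{\mathbb W}^{\emptyset}_t=1$, $\widehat{\mathbb W}^{v\mathbf i}_t=\int_0^t\widehat{\mathbb W}^v_s\circ d\widehat W^{\mathbf i}_s$ (Stratonovich; coordinate $\mathbf 1$ is time). $\widehat{\mathbb W}^{\le M}_t$ is the truncation: it agrees with $\widehat{\mathbb W}_t$ on words of length $\le M$ and is $0$ on longer words. Set $\|\ell\|_t^{\mathcal A}=\sum_{n\ge0}\big|\sum_{v\in V_n}\ell^v\widehat{\mathbb W}^v_t\big|$, $\mathcal A=\{\ell:\|\ell\|_t^{\mathcal A}<\infty\ \forall t\in[0,T]\text{ a.s.}\}$, and $\langle\ell,\widehat{\mathbb W}_t\rangle=\sum_{n\ge0}\sum_{v\in V_n}\ell^v\widehat{\mathbb W}_t^v$ for $\ell\in\mathcal A$. For a word $v$, $n(v)$ is its length and $x(v)$ its number of letters $\mathbf 1$. Set $$h_t(v)=\frac{C}{(n(v)+1)^{1/4}}\,\frac{(2t)^{\frac12(n(v)+x(v))}}{\sqrt{(n(v)+x(v)-1)!}},$$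 with $k!=1$ for $k\le0$, where $C\ge2$ is a constant independent of $v,t$ such that $\mathbb E[\sup_{s\le t}|\widehat{\mathbb W}_s^v|^2]\le h_t(v)^2$ for all words $v$ and $t\in[0,T]$ (such a constant exists). Let $\|\ell\|_t^{\mathcal A_h}=\sum_{n\ge0}\sum_{v\in V_n}|\ell^v|h_t(v)$ and $\mathcal A_h=\{\ell:\|\ell\|_T^{\mathcal A_h}<\infty\}$. *)

theory Defs
  imports "HOL-Probability.Probability"
begin

section \<open>Filtered probability spaces and Brownian motion\<close>

locale usual_conditions = prob_space M + complete_measure M
  for M :: "'w measure" +
  fixes F :: "real \<Rightarrow> 'w measure" and T :: real
  assumes subalgebra_F: "t \<in> {0..T} \<Longrightarrow> subalgebra M (F t)"
    and mono_F: "0 \<le> s \<Longrightarrow> s \<le> t \<Longrightarrow> t \<le> T \<Longrightarrow> sets (F s) \<subseteq> sets (F t)"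
    and right_continuous_F: "0 \<le> t \<Longrightarrow> t < T \<Longrightarrow> sets (F t) = (\<Inter>s\<in>{t<..T}. sets (F s))"
    and null_sets_F: "null_sets M \<subseteq> sets (F 0)"

definition continuous_adapted ::
    "'w measure \<Rightarrow> (real \<Rightarrow> 'w measure) \<Rightarrow> real \<Rightarrow> (real \<Rightarrow> 'w \<Rightarrow> real) \<Rightarrow> bool" where
  "continuous_adapted M F T X \<longleftrightarrow>
     (\<forall>t\<in>{0..T}. X t \<in> borel_measurable (F t)) \<and>
     (AE \<omega> in M. continuous_on {0..T} (\<lambda>t. X t \<omega>))"

text \<open>The components of the \<open>(d-1)\<close>-dimensional Brownian motion are indexed by \<open>2, \<dots>, d\<close>;
  \<open>W i\<close> is irrelevant for other \<open>i\<close>. It is a Brownian motion relative to the filtration \<open>F\<close>.\<close>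

definition brownian_motion ::
    "'w measure \<Rightarrow> (real \<Rightarrow> 'w measure) \<Rightarrow> real \<Rightarrow> nat \<Rightarrow> (nat \<Rightarrow> real \<Rightarrow> 'w \<Rightarrow> real) \<Rightarrow> bool" where
  "brownian_motion M F T d W \<longleftrightarrow>
     (\<forall>i\<in>{2..d}. continuous_adapted M F T (W i) \<and> (AE \<omega> in M. W i 0 \<omega> = 0)) \<and>
     (\<forall>s t. 0 \<le> s \<and> s < t \<and> t \<le> T \<longrightarrow>
        (\<forall>i\<in>{2..d}. distributed M lborel (\<lambda>\<omega>. W i t \<omega> - W i s \<omega>)
                       (\<lambda>x. ennreal (normal_density 0 (sqrt (t - s)) x))) \<and>
        prob_space.indep_vars M (\<lambda>_. borel) (\<lambda>i \<omega>. W i t \<omega> - W i s \<omega>) {2..d} \<and>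
        prob_space.indep_set M (sets (F s))
          (sets (vimage_algebra (space M) (\<lambda>\<omega>. \<lambda>i\<in>{2..d}. W i t \<omega> - W i s \<omega>)
                   (PiM {2..d} (\<lambda>_. borel)))))"


section \<open>Ito and Stratonovich integrals\<close>

text \<open>Measurability is required explicitly because \<^const>\<open>measure\<close> is \<open>0\<close> on
  non-measurable sets.\<close>

definition tendsto_in_prob ::
    "'w measure \<Rightarrow> (nat \<Rightarrow> 'w \<Rightarrow> real) \<Rightarrow> ('w \<Rightarrow> real) \<Rightarrow> bool" where
  "tendsto_in_prob M X Y \<longleftrightarrow>
     (\<forall>n. X n \<in> borel_measurable M) \<and> Y \<in> borel_measurable M \<and>
     (\<forall>\<epsilon>>0. (\<lambda>n. measure M {\<omega> \<in> space M. \<epsilon> < \<bar>X n \<omega> - Y \<omega>\<bar>}) \<longlonglongrightarrow> 0)"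

text \<open>A partition \<open>0 = p 0 \<le> \<dots> \<le> p k = t\<close> is given by its number \<open>k\<close> of intervals
  and its points \<open>p\<close>.\<close>

definition is_partition :: "real \<Rightarrow> nat \<Rightarrow> (nat \<Rightarrow> real) \<Rightarrow> bool" where
  "is_partition t k p \<longleftrightarrow> p 0 = 0 \<and> p k = t \<and> (\<forall>j<k. p j \<le> p (Suc j))"

definition mesh_tendsto_0 :: "(nat \<Rightarrow> nat) \<Rightarrow> (nat \<Rightarrow> nat \<Rightarrow> real) \<Rightarrow> bool" where
  "mesh_tendsto_0 k p \<longleftrightarrow>
     (\<forall>\<delta>>0. \<forall>\<^sub>F n in sequentially. \<forall>j<k n. p n (Suc j) - p n j < \<delta>)"

text \<open>Simple predictable integrands \<open>\<Sum>j<k. \<xi> j * indicator {p j<..p (Suc j)}\<close> with bounded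
  \<open>F (p j)\<close>-measurable \<open>\<xi> j\<close>.\<close>

definition simple_integrand ::
    "'w measure \<Rightarrow> (real \<Rightarrow> 'w measure) \<Rightarrow> real \<Rightarrow> nat \<Rightarrow> (nat \<Rightarrow> real) \<Rightarrow> (nat \<Rightarrow> 'w \<Rightarrow> real) \<Rightarrow> bool"
  where
  "simple_integrand M F T k p \<xi> \<longleftrightarrow>
     is_partition T k p \<and>
     (\<forall>j<k. \<xi> j \<in> borel_measurable (F (p j)) \<and> bounded (\<xi> j ` space M))"

definition simple_process ::
    "nat \<Rightarrow> (nat \<Rightarrow> real) \<Rightarrow> (nat \<Rightarrow> 'w \<Rightarrow> real) \<Rightarrow> real \<Rightarrow> 'w \<Rightarrow> real" where
  "simple_process k p \<xi> s \<omega> = (\<Sum>j<k. \<xi> j \<omega> * indicator {p j<..p (Suc j)} s)"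

definition simple_integral ::
    "nat \<Rightarrow> (nat \<Rightarrow> real) \<Rightarrow> (nat \<Rightarrow> 'w \<Rightarrow> real) \<Rightarrow> (real \<Rightarrow> 'w \<Rightarrow> real) \<Rightarrow> real \<Rightarrow> 'w \<Rightarrow> real" where
  "simple_integral k p \<xi> B t \<omega> = (\<Sum>j<k. \<xi> j \<omega> * (B (min t (p (Suc j))) \<omega> - B (min t (p j)) \<omega>))"

text \<open>\<open>I\<close> is (a continuous version of) the Ito integral of the continuous adapted process \<open>X\<close>
  against the Brownian motion \<open>B\<close>: the limit in probability of the integrals of simple integrands
  \<open>X\<^sub>n\<close> with \<open>\<integral>\<^sub>0\<^sup>T (X\<^sub>n - X)\<^sup>2 ds \<rightarrow> 0\<close> in probability. The limit does
  not depend on the choice of \<open>X\<^sub>n\<close>.\<close>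

definition is_ito_integral ::
    "'w measure \<Rightarrow> (real \<Rightarrow> 'w measure) \<Rightarrow> real \<Rightarrow>
     (real \<Rightarrow> 'w \<Rightarrow> real) \<Rightarrow> (real \<Rightarrow> 'w \<Rightarrow> real) \<Rightarrow> (real \<Rightarrow> 'w \<Rightarrow> real) \<Rightarrow> bool" where
  "is_ito_integral M F T X B I \<longleftrightarrow>
     continuous_adapted M F T X \<and> continuous_adapted M F T I \<and>
     (\<exists>k p \<xi>. (\<forall>n. simple_integrand M F T (k n) (p n) (\<xi> n)) \<and>
        tendsto_in_prob M
          (\<lambda>n \<omega>. LINT s:{0..T}|lborel. (simple_process (k n) (p n) (\<xi> n) s \<omega> - X s \<omega>)\<^sup>2) (\<lambda>_. 0) \<and>
        (\<forall>t\<in>{0..T}. tendsto_in_prob M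
          (\<lambda>n. simple_integral (k n) (p n) (\<xi> n) B t) (I t)))"

definition is_covariation ::
    "'w measure \<Rightarrow> (real \<Rightarrow> 'w measure) \<Rightarrow> real \<Rightarrow>
     (real \<Rightarrow> 'w \<Rightarrow> real) \<Rightarrow> (real \<Rightarrow> 'w \<Rightarrow> real) \<Rightarrow> (real \<Rightarrow> 'w \<Rightarrow> real) \<Rightarrow> bool" where
  "is_covariation M F T X Y Q \<longleftrightarrow>
     continuous_adapted M F T Q \<and>
     (\<forall>t\<in>{0..T}. \<forall>k p. (\<forall>n. is_partition t (k n) (p n)) \<and> mesh_tendsto_0 k p \<longrightarrow>
        tendsto_in_prob M
          (\<lambda>n \<omega>. \<Sum>j<k n. (X (p n (Suc j)) \<omega> - X (p n j) \<omega>) * (Y (p n (Suc j)) \<omega> - Y (p n j) \<omega>))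
          (Q t))"

definition is_stratonovich_integral ::
    "'w measure \<Rightarrow> (real \<Rightarrow> 'w measure) \<Rightarrow> real \<Rightarrow>
     (real \<Rightarrow> 'w \<Rightarrow> real) \<Rightarrow> (real \<Rightarrow> 'w \<Rightarrow> real) \<Rightarrow> (real \<Rightarrow> 'w \<Rightarrow> real) \<Rightarrow> bool" where
  "is_stratonovich_integral M F T X B Z \<longleftrightarrow>
     (\<exists>I Q. is_ito_integral M F T X B I \<and> is_covariation M F T X B Q \<and>
        (AE \<omega> in M. \<forall>t\<in>{0..T}. Z t \<omega> = I t \<omega> + Q t \<omega> / 2))"


section \<open>Words, formal series and the signature\<close>

text \<open>Letters are \<open>1, \<dots>, d\<close>. A formal series is the function \<open>l :: nat list \<Rightarrow> real\<close> of its
  coefficients; only the values on words over \<open>{1..d}\<close> are ever used.\<close>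

definition words :: "nat \<Rightarrow> nat \<Rightarrow> nat list set" where
  "words d n = {v. length v = n \<and> set v \<subseteq> {1..d}}"

text \<open>\<open>S t \<omega>\<close> is the signature at time \<open>t\<close>, with \<open>S t \<omega> v\<close> its coefficient at the word \<open>v\<close>.
  The signature is determined up to indistinguishability only, hence a predicate. The Stratonovich
  integral against the time coordinate (letter \<open>1\<close>) is the pathwise Lebesgue integral.\<close>

definition is_signature ::
    "'w measure \<Rightarrow> (real \<Rightarrow> 'w measure) \<Rightarrow> real \<Rightarrow> nat \<Rightarrow> (nat \<Rightarrow> real \<Rightarrow> 'w \<Rightarrow> real) \<Rightarrow>
     (real \<Rightarrow> 'w \<Rightarrow> nat list \<Rightarrow> real) \<Rightarrow> bool" where
  "is_signature M F T d W S \<longleftrightarrow>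
     (\<forall>v\<in>lists {1..d}. continuous_adapted M F T (\<lambda>t \<omega>. S t \<omega> v)) \<and>
     (AE \<omega> in M. \<forall>t\<in>{0..T}. S t \<omega> [] = 1) \<and>
     (\<forall>v\<in>lists {1..d}.
        (AE \<omega> in M. \<forall>t\<in>{0..T}. S t \<omega> (v @ [1]) = (LINT s:{0..t}|lborel. S s \<omega> v)) \<and>
        (\<forall>i\<in>{2..d}. is_stratonovich_integral M F T
                       (\<lambda>t \<omega>. S t \<omega> v) (W i) (\<lambda>t \<omega>. S t \<omega> (v @ [i]))))"

definition truncate :: "nat \<Rightarrow> (nat list \<Rightarrow> real) \<Rightarrow> nat list \<Rightarrow> real" where
  "truncate m p v = (if length v \<le> m then p v else 0)"

definition pairing :: "nat \<Rightarrow> (nat list \<Rightarrow> real) \<Rightarrow> (nat list \<Rightarrow> real) \<Rightarrow> real" where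
  "pairing d l p = (\<Sum>n. \<Sum>v\<in>words d n. l v * p v)"

definition norm_A :: "nat \<Rightarrow> (nat list \<Rightarrow> real) \<Rightarrow> (nat list \<Rightarrow> real) \<Rightarrow> ennreal" where
  "norm_A d l p = (\<Sum>n. ennreal \<bar>\<Sum>v\<in>words d n. l v * p v\<bar>)"

definition space_A ::
    "'w measure \<Rightarrow> real \<Rightarrow> nat \<Rightarrow> (real \<Rightarrow> 'w \<Rightarrow> nat list \<Rightarrow> real) \<Rightarrow> (nat list \<Rightarrow> real) set" where
  "space_A M T d S = {l. AE \<omega> in M. \<forall>t\<in>{0..T}. norm_A d l (S t \<omega>) < \<infinity>}"

text \<open>The power \<open>(2t)^((n+x)/2)\<close> is written with \<^const>\<open>sqrt\<close>, since \<open>0 powr 0 = 0\<close> whereas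
  \<open>h\<close> at \<open>t = 0\<close> requires \<open>0^0 = 1\<close> for the empty word. Natural-number subtraction implements the
  convention \<open>k! = 1\<close> for \<open>k \<le> 0\<close>.\<close>

definition h :: "real \<Rightarrow> real \<Rightarrow> nat list \<Rightarrow> real" where
  "h C t v =
     (let n = length v; x = count_list v 1
      in C / (real n + 1) powr (1/4) * (sqrt (2 * t) ^ (n + x) / sqrt (fact (n + x - 1))))"

definition norm_Ah :: "nat \<Rightarrow> real \<Rightarrow> real \<Rightarrow> (nat list \<Rightarrow> real) \<Rightarrow> ennreal" where
  "norm_Ah d C t l = (\<Sum>n. ennreal (\<Sum>v\<in>words d n. \<bar>l v\<bar> * h C t v))"

definition space_Ah :: "nat \<Rightarrow> real \<Rightarrow> real \<Rightarrow> (nat list \<Rightarrow> real) set" where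
  "space_Ah d C T = {l. norm_Ah d C T l < \<infinity>}"

text \<open>\<^const>\<open>nn_integral\<close> of a non-measurable function is only a lower integral, so an
  expectation bound includes measurability.\<close>

definition expectation_le :: "'w measure \<Rightarrow> ('w \<Rightarrow> ennreal) \<Rightarrow> ennreal \<Rightarrow> bool" where
  "expectation_le M X c \<longleftrightarrow> X \<in> borel_measurable M \<and> (\<integral>\<^sup>+ \<omega>. X \<omega> \<partial>M) \<le> c"

end

theory Submission
  imports Defs
begin

text \<open>
  Everything rests on one comparison made path by path. Let \<open>Y\<^sub>v\<close> be the supremum over
  \<open>[0, t]\<close> of \<open>\<bar>S\<^sub>s(v)\<bar>\<close> and put \<open>A\<^sub>n = \<Sum>\<^bsub>\<bar>v\<bar> = n\<^esub> \<bar>l\<^sup>v\<bar> Y\<^sub>v\<close>.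
  The \<open>n\<close>-th level of the pairing of \<open>l\<close> with \<open>S\<^sub>s\<close> is at most \<open>A\<^sub>n\<close> in absolute value,
  uniformly in \<open>s\<close>. So the \<open>\<A>\<close>-norm and the absolute value of the pairing are at most
  \<open>\<Sum>\<^sub>n A\<^sub>n\<close>, and where this sum is finite the truncation error is at most its tail.

  The hypothesis on \<open>h\<close> says that \<open>Y\<^sub>v\<close> has \<open>L\<^sup>2\<close>-norm at most \<open>h\<^sub>t(v)\<close>. Minkowski's
  inequality, for finite sums and for series, turns this into the \<open>L\<^sup>2\<close>-bound
  \<open>\<Sum>\<^sub>n \<Sum>\<^bsub>\<bar>v\<bar> = n\<^esub> \<bar>l\<^sup>v\<bar> h\<^sub>t(v)\<close> for \<open>\<Sum>\<^sub>n A\<^sub>n\<close>, which is (ii); on a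
  probability space the mean is at most the \<open>L\<^sup>2\<close>-norm, which gives the two bounds on first moments
  in (i) and (iii). At \<open>t = T\<close> the bound is finite, so \<open>\<Sum>\<^sub>n A\<^sub>n\<close> is finite almost surely;
  this gives the inclusion of the two spaces. The same finiteness feeds the Weierstrass test: the
  pairing is almost surely a uniform limit of continuous functions of time.

  The suprema run over uncountable sets, and the processes are continuous only almost surely.
  Their measurability comes from a countable dense set of times together with the completeness of
  the probability space; the \<open>\<A>\<close>-norm is an increasing limit of continuous processes, and
  the two suprema can be exchanged.
\<close>

section \<open>Suprema of continuous processes\<close>

lemma (in complete_measure) borel_measurable_AE_eq:
  fixes f g :: "'a \<Rightarrow> ennreal"
  assumes g: "g \<in> borel_measurable M" and eq: "AE x in M. f x = g x"
  shows "f \<in> borel_measurable M"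
proof (rule measurableI)
  fix A :: "ennreal set" assume A: "A \<in> sets borel"
  show "f -` A \<inter> space M \<in> sets M"
  proof (rule in_sets_AE)
    show "g -` A \<inter> space M \<in> sets M"
      using g A by (rule measurable_sets)
    show "AE x in M. (x \<in> g -` A \<inter> space M) = (x \<in> f -` A \<inter> space M)"
      using eq by eventually_elim auto
  qed auto
qed simp

lemma SUP_continuous_dense_subset:
  fixes f :: "real \<Rightarrow> real"
  assumes f: "continuous_on A f" and D: "D \<subseteq> A" "A \<subseteq> closure D"
  shows "(SUP s\<in>A. ennreal \<bar>f s\<bar>) = (SUP s\<in>D. ennreal \<bar>f s\<bar>)"
proof (rule antisym)
  show "(SUP s\<in>D. ennreal \<bar>f s\<bar>) \<le> (SUP s\<in>A. ennreal \<bar>f s\<bar>)"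
    using D(1) by (rule SUP_subset_mono) simp
  show "(SUP s\<in>A. ennreal \<bar>f s\<bar>) \<le> (SUP s\<in>D. ennreal \<bar>f s\<bar>)"
  proof (rule SUP_least)
    fix s assume s: "s \<in> A"
    then have "s \<in> closure D"
      using D(2) by blast
    then obtain x where x: "\<And>n. x n \<in> D" "x \<longlonglongrightarrow> s"
      unfolding closure_sequential by blast
    have "(\<lambda>n. f (x n)) \<longlonglongrightarrow> f s"
      using f s x D(1) by (auto simp: continuous_on_sequentially comp_def)
    then have "(\<lambda>n. ennreal \<bar>f (x n)\<bar>) \<longlonglongrightarrow> ennreal \<bar>f s\<bar>"
      by (intro tendsto_ennrealI tendsto_rabs)
    then show "ennreal \<bar>f s\<bar> \<le> (SUP s\<in>D. ennreal \<bar>f s\<bar>)"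
      by (rule Lim_bounded) (auto intro: SUP_upper x(1))
  qed
qed

text \<open>Off a null set, the supremum may be taken over a countable dense set of times; by
  completeness, what happens on that null set does not affect measurability.\<close>

lemma (in complete_measure) borel_measurable_SUP_continuous:
  fixes X :: "real \<Rightarrow> 'a \<Rightarrow> real"
  assumes meas: "\<And>s. s \<in> A \<Longrightarrow> X s \<in> borel_measurable M"
    and cont: "AE \<omega> in M. continuous_on A (\<lambda>s. X s \<omega>)"
  shows "(\<lambda>\<omega>. SUP s\<in>A. ennreal \<bar>X s \<omega>\<bar>) \<in> borel_measurable M"
proof -
  obtain D where D: "countable D" "D \<subseteq> A" "A \<subseteq> closure D"
    using separable[of A] by metis
  show ?thesis
  proof (rule borel_measurable_AE_eq)
    show "(\<lambda>\<omega>. SUP s\<in>D. ennreal \<bar>X s \<omega>\<bar>) \<in> borel_measurable M"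
    proof (rule borel_measurable_SUP[OF D(1)])
      fix s assume "s \<in> D"
      then have [measurable]: "X s \<in> borel_measurable M"
        using meas D(2) by auto
      show "(\<lambda>\<omega>. ennreal \<bar>X s \<omega>\<bar>) \<in> borel_measurable M"
        by measurable
    qed
    show "AE \<omega> in M. (SUP s\<in>A. ennreal \<bar>X s \<omega>\<bar>) = (SUP s\<in>D. ennreal \<bar>X s \<omega>\<bar>)"
      using cont by eventually_elim (rule SUP_continuous_dense_subset[OF _ D(2,3)])
  qed
qed

text \<open>The square of the supremum is the supremum of the products \<open>f i * f j\<close>, and each product
  is at most the square of its larger factor.\<close>

lemma SUP_power2_ennreal:
  fixes f :: "'i \<Rightarrow> ennreal"
  shows "(SUP i\<in>I. f i)\<^sup>2 = (SUP i\<in>I. (f i)\<^sup>2)"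
proof (rule antisym)
  have "f i * f j \<le> (SUP i\<in>I. (f i)\<^sup>2)" if "i \<in> I" "j \<in> I" for i j
  proof (cases "f i \<le> f j")
    case True
    then have "f i * f j \<le> (f j)\<^sup>2"
      by (auto simp: power2_eq_square intro: mult_right_mono)
    also have "\<dots> \<le> (SUP i\<in>I. (f i)\<^sup>2)"
      using that by (intro SUP_upper)
    finally show ?thesis .
  next
    case False
    then have "f i * f j \<le> (f i)\<^sup>2"
      by (auto simp: power2_eq_square intro: mult_left_mono)
    also have "\<dots> \<le> (SUP i\<in>I. (f i)\<^sup>2)"
      using that by (intro SUP_upper)
    finally show ?thesis .
  qed
  then show "(SUP i\<in>I. f i)\<^sup>2 \<le> (SUP i\<in>I. (f i)\<^sup>2)"
    by (auto simp: power2_eq_square SUP_mult_left_ennreal SUP_mult_right_ennreal intro!: SUP_least)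
  show "(SUP i\<in>I. (f i)\<^sup>2) \<le> (SUP i\<in>I. f i)\<^sup>2"
    by (intro SUP_least power_mono SUP_upper) auto
qed

section \<open>Bounds in \<open>L\<^sup>2\<close>\<close>

text \<open>The inequality \<open>\<parallel>f\<parallel>\<^sub>2 \<le> a\<close>, squared so that no root of an extended number occurs. Infinite
  values are allowed, so that series can be bounded before they are known to be finite.\<close>

definition L2_le :: "'a measure \<Rightarrow> ('a \<Rightarrow> ennreal) \<Rightarrow> ennreal \<Rightarrow> bool" where
  "L2_le M f a \<longleftrightarrow> f \<in> borel_measurable M \<and> (\<integral>\<^sup>+ x. (f x)\<^sup>2 \<partial>M) \<le> a\<^sup>2"

lemma power2_le_power2_ennrealD:
  fixes x y :: ennreal
  assumes "x\<^sup>2 \<le> y\<^sup>2"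
  shows "x \<le> y"
proof (rule ccontr)
  assume "\<not> x \<le> y"
  then have "y < x" by simp
  then have "y\<^sup>2 < x\<^sup>2"
    by (cases x; cases y)
      (auto simp: ennreal_power ennreal_less_iff power_strict_mono less_top[symmetric] power_eq_top_ennreal)
  with assms show False
    by simp
qed

lemma L2_le_integral_mult:
  assumes "L2_le M f a" "L2_le M g b"
  shows "(\<integral>\<^sup>+ x. f x * g x \<partial>M) \<le> a * b"
proof (rule power2_le_power2_ennrealD)
  have "(\<integral>\<^sup>+ x. f x * g x \<partial>M)\<^sup>2 \<le> (\<integral>\<^sup>+ x. (f x)\<^sup>2 \<partial>M) * (\<integral>\<^sup>+ x. (g x)\<^sup>2 \<partial>M)"
    using assms by (intro Cauchy_Schwarz_nn_integral) (auto simp: L2_le_def)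
  also have "\<dots> \<le> a\<^sup>2 * b\<^sup>2"
    using assms by (intro mult_mono) (auto simp: L2_le_def)
  finally show "(\<integral>\<^sup>+ x. f x * g x \<partial>M)\<^sup>2 \<le> (a * b)\<^sup>2"
    by (simp add: power_mult_distrib)
qed

text \<open>Cauchy--Schwarz against the constant function \<open>1\<close>.\<close>

lemma (in prob_space) L2_le_integral:
  assumes "L2_le M f a"
  shows "(\<integral>\<^sup>+ x. f x \<partial>M) \<le> a"
proof -
  have "L2_le M (\<lambda>_. 1) 1"
    by (simp add: L2_le_def emeasure_space_1)
  from L2_le_integral_mult[OF assms this] show ?thesis
    by simp
qed

text \<open>Minkowski's inequality for series: the square of the sum expands into a double series of
  nonnegative terms, which can be integrated term by term, and Cauchy--Schwarz bounds the
  \<open>(n, k)\<close> term by \<open>a n * a k\<close>.\<close>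

lemma L2_le_suminf:
  fixes f :: "nat \<Rightarrow> 'a \<Rightarrow> ennreal"
  assumes "\<And>n. L2_le M (f n) (a n)"
  shows "L2_le M (\<lambda>x. \<Sum>n. f n x) (\<Sum>n. a n)"
proof -
  have [measurable]: "\<And>n. f n \<in> borel_measurable M"
    using assms by (auto simp: L2_le_def)
  have sq: "(\<Sum>n. b n)\<^sup>2 = (\<Sum>n. \<Sum>k. b n * b k)" for b :: "nat \<Rightarrow> ennreal"
    by (simp add: power2_eq_square)
  have "(\<integral>\<^sup>+ x. (\<Sum>n. f n x)\<^sup>2 \<partial>M) = (\<Sum>n. \<Sum>k. \<integral>\<^sup>+ x. f n x * f k x \<partial>M)"
    by (simp add: sq nn_integral_suminf del: ennreal_suminf_cmult ennreal_suminf_multc)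
  also have "\<dots> \<le> (\<Sum>n. \<Sum>k. a n * a k)"
    by (intro suminf_le L2_le_integral_mult assms) auto
  finally show ?thesis
    by (simp add: L2_le_def sq)
qed

lemma L2_le_cmult:
  assumes "L2_le M f a"
  shows "L2_le M (\<lambda>x. c * f x) (c * a)"
  using assms
  by (auto simp: L2_le_def power_mult_distrib nn_integral_cmult intro!: mult_left_mono)

lemma L2_le_sum:
  assumes "finite I" "\<And>i. i \<in> I \<Longrightarrow> L2_le M (f i) (a i)"
  shows "L2_le M (\<lambda>x. \<Sum>i\<in>I. f i x) (\<Sum>i\<in>I. a i)"
proof -
  have [measurable]: "\<And>i. i \<in> I \<Longrightarrow> f i \<in> borel_measurable M"
    using assms(2) by (auto simp: L2_le_def)
  have sq: "(\<Sum>i\<in>I. b i)\<^sup>2 = (\<Sum>i\<in>I. \<Sum>j\<in>I. b i * b j)" for b :: "_ \<Rightarrow> ennreal"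
    by (simp add: power2_eq_square sum_product)
  have "(\<integral>\<^sup>+ x. (\<Sum>i\<in>I. f i x)\<^sup>2 \<partial>M) = (\<Sum>i\<in>I. \<Sum>j\<in>I. \<integral>\<^sup>+ x. f i x * f j x \<partial>M)"
    by (simp add: sq nn_integral_sum)
  also have "\<dots> \<le> (\<Sum>i\<in>I. \<Sum>j\<in>I. a i * a j)"
    by (intro sum_mono L2_le_integral_mult assms)
  finally show ?thesis
    by (simp add: L2_le_def sq)
qed

section \<open>Levels of the pairing\<close>

lemma finite_words [simp]: "finite (words d n)"
  using finite_lists_length_eq[of "{1..d}" n] by (simp add: words_def conj_commute)

text \<open>For a series that does not converge absolutely, the left-hand side may be an arbitrary default
  value, but the right-hand side is then infinite.\<close>

lemma ennreal_abs_suminf_le: "ennreal \<bar>\<Sum>n. f n\<bar> \<le> (\<Sum>n. ennreal \<bar>f n\<bar>)"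
proof (cases "(\<Sum>n. ennreal \<bar>f n\<bar>) = \<top>")
  case False
  then have s: "summable (\<lambda>n. \<bar>f n\<bar>)"
    by (intro summable_suminf_not_top) auto
  then have "ennreal \<bar>\<Sum>n. f n\<bar> \<le> ennreal (\<Sum>n. \<bar>f n\<bar>)"
    by (intro ennreal_leI summable_rabs)
  also have "\<dots> = (\<Sum>n. ennreal \<bar>f n\<bar>)"
    using s by (intro suminf_ennreal2[symmetric]) auto
  finally show ?thesis .
qed simp

definition level :: "nat \<Rightarrow> (nat list \<Rightarrow> real) \<Rightarrow> nat \<Rightarrow> (nat list \<Rightarrow> real) \<Rightarrow> real" where
  "level d l n p = (\<Sum>v\<in>words d n. l v * p v)"

lemma pairing_eq_level: "pairing d l p = (\<Sum>n. level d l n p)"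
  by (simp add: pairing_def level_def)

lemma norm_A_eq_level: "norm_A d l p = (\<Sum>n. ennreal \<bar>level d l n p\<bar>)"
  by (simp add: norm_A_def level_def)

lemma abs_pairing_le_norm_A: "ennreal \<bar>pairing d l p\<bar> \<le> norm_A d l p"
  unfolding pairing_eq_level norm_A_eq_level by (rule ennreal_abs_suminf_le)

lemma level_truncate: "level d l n (truncate m p) = (if n \<le> m then level d l n p else 0)"
  by (auto simp: level_def truncate_def words_def intro: sum.cong)

lemma pairing_truncate_finite:
  "pairing d l (truncate m p) = (\<Sum>n\<le>m. level d l n p)"
proof -
  have "pairing d l (truncate m p) = (\<Sum>n\<le>m. level d l n (truncate m p))"
    unfolding pairing_eq_level by (rule suminf_finite) (auto simp: level_truncate)
  then show ?thesis
    by (simp add: level_truncate)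
qed

text \<open>The error is the tail starting at level \<open>m + 1\<close>. The bound starts at level \<open>m\<close>, as does
  the sum in the final estimate. Finiteness of the norm makes the pairing a convergent
  series, so that splitting off the first \<open>m + 1\<close> levels is legitimate.\<close>

lemma pairing_truncate_diff_le:
  assumes "norm_A d l p < \<infinity>"
  shows "ennreal \<bar>pairing d l (truncate m p) - pairing d l p\<bar> \<le> (\<Sum>n. ennreal \<bar>level d l (n + m) p\<bar>)"
proof -
  have "summable (\<lambda>n. \<bar>level d l n p\<bar>)"
    using assms by (intro summable_suminf_not_top) (auto simp: norm_A_eq_level)
  then have s: "summable (\<lambda>n. level d l n p)"
    by (rule summable_rabs_cancel)
  have "pairing d l p = (\<Sum>n. level d l (n + Suc m) p) + (\<Sum>n\<le>m. level d l n p)"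
    unfolding pairing_eq_level lessThan_Suc_atMost[symmetric]
    by (rule suminf_split_initial_segment[OF s])
  then have "ennreal \<bar>pairing d l (truncate m p) - pairing d l p\<bar> = ennreal \<bar>\<Sum>n. level d l (n + Suc m) p\<bar>"
    by (simp add: pairing_truncate_finite)
  also have "\<dots> \<le> (\<Sum>n. ennreal \<bar>level d l (n + Suc m) p\<bar>)"
    by (rule ennreal_abs_suminf_le)
  also have "\<dots> \<le> (\<Sum>n. ennreal \<bar>level d l (n + m) p\<bar>)"
    by (subst suminf_offset[of "\<lambda>n. ennreal \<bar>level d l (n + m) p\<bar>" 1]) simp_all
  finally show ?thesis .
qed

section \<open>Second-moment domination\<close>

text \<open>The estimates concern any family of continuous processes indexed by words whose running
  suprema have second moments at most \<open>H\<^sup>2\<close>; the signature with \<open>H = h\<close> is such a family.\<close>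

locale dominated_coefficients = prob_space M + complete_measure M
  for M :: "'w measure" +
  fixes T :: real and d :: nat and S :: "real \<Rightarrow> 'w \<Rightarrow> nat list \<Rightarrow> real"
    and H :: "real \<Rightarrow> nat list \<Rightarrow> real"
  assumes coefficient_measurable:
      "v \<in> lists {1..d} \<Longrightarrow> t \<in> {0..T} \<Longrightarrow> (\<lambda>\<omega>. S t \<omega> v) \<in> borel_measurable M"
    and coefficient_continuous:
      "v \<in> lists {1..d} \<Longrightarrow> AE \<omega> in M. continuous_on {0..T} (\<lambda>t. S t \<omega> v)"
    and H_nonneg: "t \<in> {0..T} \<Longrightarrow> 0 \<le> H t v"
    and second_moment:
      "v \<in> lists {1..d} \<Longrightarrow> t \<in> {0..T} \<Longrightarrow>
        (\<integral>\<^sup>+ \<omega>. (SUP s\<in>{0..t}. ennreal (\<bar>S s \<omega> v\<bar>\<^sup>2)) \<partial>M) \<le> ennreal ((H t v)\<^sup>2)"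
begin

definition running_sup :: "real \<Rightarrow> nat list \<Rightarrow> 'w \<Rightarrow> ennreal" where
  "running_sup t v \<omega> = (SUP s\<in>{0..t}. ennreal \<bar>S s \<omega> v\<bar>)"

text \<open>The pathwise majorant of the \<open>n\<close>-th level on \<open>[0, t]\<close>. Its \<open>L\<^sup>2\<close>-norm is at most the
  deterministic \<open>level_norm l t n\<close>, and it enters every estimate below.\<close>

definition level_sup :: "(nat list \<Rightarrow> real) \<Rightarrow> real \<Rightarrow> nat \<Rightarrow> 'w \<Rightarrow> ennreal" where
  "level_sup l t n \<omega> = (\<Sum>v\<in>words d n. ennreal \<bar>l v\<bar> * running_sup t v \<omega>)"

definition level_norm :: "(nat list \<Rightarrow> real) \<Rightarrow> real \<Rightarrow> nat \<Rightarrow> ennreal" where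
  "level_norm l t n = ennreal (\<Sum>v\<in>words d n. \<bar>l v\<bar> * H t v)"

lemma L2_le_running_sup:
  assumes v: "v \<in> lists {1..d}" and t: "t \<in> {0..T}"
  shows "L2_le M (running_sup t v) (ennreal (H t v))"
proof -
  have sub: "{0..t} \<subseteq> {0..T}"
    using t by auto
  have "(\<lambda>\<omega>. SUP s\<in>{0..t}. ennreal \<bar>S s \<omega> v\<bar>) \<in> borel_measurable M"
  proof (rule borel_measurable_SUP_continuous)
    show "AE \<omega> in M. continuous_on {0..t} (\<lambda>s. S s \<omega> v)"
      using coefficient_continuous[OF v]
      by eventually_elim (rule continuous_on_subset[OF _ sub])
  qed (use coefficient_measurable[OF v] sub in auto)
  moreover have "(running_sup t v \<omega>)\<^sup>2 = (SUP s\<in>{0..t}. ennreal (\<bar>S s \<omega> v\<bar>\<^sup>2))" for \<omega>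
    by (simp add: running_sup_def SUP_power2_ennreal ennreal_power)
  ultimately show ?thesis
    using second_moment[OF v t] H_nonneg[OF t]
    by (simp add: L2_le_def running_sup_def[abs_def] ennreal_power)
qed

lemma L2_le_level_sup:
  assumes t: "t \<in> {0..T}"
  shows "L2_le M (level_sup l t n) (level_norm l t n)"
proof -
  have "level_norm l t n = (\<Sum>v\<in>words d n. ennreal \<bar>l v\<bar> * ennreal (H t v))"
    using H_nonneg[OF t] by (simp add: level_norm_def ennreal_mult flip: sum_ennreal)
  moreover have "L2_le M (level_sup l t n) (\<Sum>v\<in>words d n. ennreal \<bar>l v\<bar> * ennreal (H t v))"
    unfolding level_sup_def[abs_def]
    by (intro L2_le_sum L2_le_cmult L2_le_running_sup t finite_words) (auto simp: words_def)
  ultimately show ?thesis by simp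
qed

lemma level_le_level_sup:
  assumes "s \<in> {0..t}"
  shows "ennreal \<bar>level d l n (S s \<omega>)\<bar> \<le> level_sup l t n \<omega>"
proof -
  have "ennreal \<bar>level d l n (S s \<omega>)\<bar> \<le> ennreal (\<Sum>v\<in>words d n. \<bar>l v\<bar> * \<bar>S s \<omega> v\<bar>)"
    unfolding level_def by (intro ennreal_leI order_trans[OF sum_abs]) (simp add: abs_mult)
  also have "\<dots> = (\<Sum>v\<in>words d n. ennreal \<bar>l v\<bar> * ennreal \<bar>S s \<omega> v\<bar>)"
    by (simp add: ennreal_mult flip: sum_ennreal)
  also have "\<dots> \<le> level_sup l t n \<omega>"
    unfolding level_sup_def running_sup_def using assms
    by (intro sum_mono mult_left_mono SUP_upper) auto
  finally show ?thesis .
qed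

lemma norm_A_le_suminf_level_sup:
  assumes "s \<in> {0..t}"
  shows "norm_A d l (S s \<omega>) \<le> (\<Sum>n. level_sup l t n \<omega>)"
  unfolding norm_A_eq_level by (intro suminf_le level_le_level_sup assms) auto

lemma level_measurable:
  assumes "t \<in> {0..T}"
  shows "(\<lambda>\<omega>. level d l n (S t \<omega>)) \<in> borel_measurable M"
  unfolding level_def using assms coefficient_measurable
  by (intro borel_measurable_sum borel_measurable_times borel_measurable_const) (auto simp: words_def)

lemma AE_level_continuous: "AE \<omega> in M. \<forall>n. continuous_on {0..T} (\<lambda>t. level d l n (S t \<omega>))"
proof -
  have "AE \<omega> in M. \<forall>v\<in>words d n. continuous_on {0..T} (\<lambda>t. S t \<omega> v)" for n
    by (intro AE_finite_allI finite_words coefficient_continuous) (auto simp: words_def)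
  then have "AE \<omega> in M. continuous_on {0..T} (\<lambda>t. level d l n (S t \<omega>))" for n
    unfolding level_def by (rule AE_mp) (auto intro!: AE_I2 continuous_intros)
  then show ?thesis
    by (simp add: AE_all_countable)
qed

lemma AE_suminf_level_sup_finite:
  assumes "0 \<le> T" "(\<Sum>n. level_norm l T n) < \<infinity>"
  shows "AE \<omega> in M. (\<Sum>n. level_sup l T n \<omega>) < \<infinity>"
proof -
  have L2: "L2_le M (\<lambda>\<omega>. \<Sum>n. level_sup l T n \<omega>) (\<Sum>n. level_norm l T n)"
    using assms(1) by (intro L2_le_suminf L2_le_level_sup) auto
  then have "(\<integral>\<^sup>+ \<omega>. (\<Sum>n. level_sup l T n \<omega>) \<partial>M) \<noteq> \<infinity>"
    using L2_le_integral[OF L2] assms(2) by (auto simp: top_unique)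
  with L2 show ?thesis
    using nn_integral_noteq_infinite[of "\<lambda>\<omega>. \<Sum>n. level_sup l T n \<omega>" M]
    by (auto simp: L2_le_def less_top)
qed

text \<open>On almost every path the numbers \<open>level_sup l T n \<omega>\<close> form a summable majorant of the levels,
  uniform in time, to which the Weierstrass test applies.\<close>

lemma AE_pairing_continuous:
  assumes "0 \<le> T" "(\<Sum>n. level_norm l T n) < \<infinity>"
  shows "AE \<omega> in M. continuous_on {0..T} (\<lambda>t. pairing d l (S t \<omega>))"
  using AE_suminf_level_sup_finite[OF assms] AE_level_continuous[of l]
proof eventually_elim
  case (elim \<omega>)
  define B where "B n = enn2real (level_sup l T n \<omega>)" for n
  have fin: "level_sup l T n \<omega> \<noteq> \<top>" for n
    using ennreal_suminf_lessD[OF elim(1), of n] by simp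
  have "summable B"
    using elim(1) fin by (intro summable_suminf_not_top) (auto simp: B_def less_top)
  moreover have "norm (level d l n (S t \<omega>)) \<le> B n" if "t \<in> {0..T}" for n t
    using enn2real_mono[OF level_le_level_sup[OF that, of l n \<omega>]] fin[of n]
    by (simp add: B_def less_top)
  ultimately have lim: "uniform_limit {0..T} (\<lambda>N t. \<Sum>n<N. level d l n (S t \<omega>))
      (\<lambda>t. \<Sum>n. level d l n (S t \<omega>)) sequentially"
    by (intro Weierstrass_m_test) auto
  show ?case
    unfolding pairing_eq_level
  proof (rule uniform_limit_theorem[OF _ lim])
    show "\<forall>\<^sub>F N in sequentially. continuous_on {0..T} (\<lambda>t. \<Sum>n<N. level d l n (S t \<omega>))"
      using elim(2) by (intro always_eventually allI continuous_on_sum) auto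
  qed simp
qed

text \<open>The norm is an increasing limit of its partial sums. Each partial sum is a continuous process,
  so its supremum over time is measurable; exchanging the two suprema leaves a countable one.\<close>

lemma SUP_norm_A_measurable:
  assumes t: "t \<in> {0..T}"
  shows "(\<lambda>\<omega>. SUP s\<in>{0..t}. norm_A d l (S s \<omega>)) \<in> borel_measurable M"
proof -
  have sub: "{0..t} \<subseteq> {0..T}"
    using t by auto
  have "(\<lambda>\<omega>. SUP s\<in>{0..t}. ennreal \<bar>\<Sum>n<N. \<bar>level d l n (S s \<omega>)\<bar>\<bar>) \<in> borel_measurable M" for N
  proof (rule borel_measurable_SUP_continuous)
    show "AE \<omega> in M. continuous_on {0..t} (\<lambda>s. \<Sum>n<N. \<bar>level d l n (S s \<omega>)\<bar>)"
      using AE_level_continuous[of l]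
      by eventually_elim (auto intro!: continuous_intros continuous_on_subset[OF _ sub])
    show "(\<lambda>\<omega>. \<Sum>n<N. \<bar>level d l n (S s \<omega>)\<bar>) \<in> borel_measurable M" if "s \<in> {0..t}" for s
      using that sub by (intro borel_measurable_sum borel_measurable_abs level_measurable) auto
  qed
  then have "(\<lambda>\<omega>. SUP N. SUP s\<in>{0..t}. ennreal \<bar>\<Sum>n<N. \<bar>level d l n (S s \<omega>)\<bar>\<bar>) \<in> borel_measurable M"
    by (rule borel_measurable_SUP[OF countableI_type])
  moreover have "(SUP N. SUP s\<in>{0..t}. ennreal \<bar>\<Sum>n<N. \<bar>level d l n (S s \<omega>)\<bar>\<bar>)
      = (SUP s\<in>{0..t}. norm_A d l (S s \<omega>))" for \<omega>
    unfolding norm_A_eq_level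
    by (subst SUP_commute) (simp add: suminf_eq_SUP sum_nonneg flip: sum_ennreal)
  ultimately show ?thesis by simp
qed

lemma integral_SUP_norm_A_le:
  assumes t: "t \<in> {0..T}"
  shows "expectation_le M (\<lambda>\<omega>. SUP s\<in>{0..t}. norm_A d l (S s \<omega>)) (\<Sum>n. level_norm l t n)"
proof -
  have "(\<integral>\<^sup>+ \<omega>. (SUP s\<in>{0..t}. norm_A d l (S s \<omega>)) \<partial>M) \<le> (\<integral>\<^sup>+ \<omega>. (\<Sum>n. level_sup l t n \<omega>) \<partial>M)"
    by (intro nn_integral_mono SUP_least norm_A_le_suminf_level_sup)
  also have "\<dots> \<le> (\<Sum>n. level_norm l t n)"
    by (intro L2_le_integral L2_le_suminf L2_le_level_sup t)
  finally show ?thesis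
    using SUP_norm_A_measurable[OF t] by (simp add: expectation_le_def)
qed

lemma pairing_measurable:
  assumes "t \<in> {0..T}"
  shows "(\<lambda>\<omega>. pairing d l (S t \<omega>)) \<in> borel_measurable M"
  unfolding pairing_eq_level by (intro borel_measurable_suminf level_measurable assms)

lemma integral_SUP_pairing_power2_le:
  assumes t: "t \<in> {0..T}" and l: "(\<Sum>n. level_norm l T n) < \<infinity>"
  shows "expectation_le M (\<lambda>\<omega>. SUP s\<in>{0..t}. ennreal ((pairing d l (S s \<omega>))\<^sup>2))
    ((\<Sum>n. level_norm l t n)\<^sup>2)"
proof -
  have sub: "{0..t} \<subseteq> {0..T}" and "0 \<le> T"
    using t by auto
  have "(\<lambda>\<omega>. SUP s\<in>{0..t}. ennreal \<bar>(pairing d l (S s \<omega>))\<^sup>2\<bar>) \<in> borel_measurable M"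
  proof (rule borel_measurable_SUP_continuous)
    show "AE \<omega> in M. continuous_on {0..t} (\<lambda>s. (pairing d l (S s \<omega>))\<^sup>2)"
      using AE_pairing_continuous[OF \<open>0 \<le> T\<close> l]
      by eventually_elim (auto intro!: continuous_intros continuous_on_subset[OF _ sub])
    show "(\<lambda>\<omega>. (pairing d l (S s \<omega>))\<^sup>2) \<in> borel_measurable M" if "s \<in> {0..t}" for s
      using that sub by (intro borel_measurable_power pairing_measurable) auto
  qed
  moreover have "(\<integral>\<^sup>+ \<omega>. (SUP s\<in>{0..t}. ennreal ((pairing d l (S s \<omega>))\<^sup>2)) \<partial>M)
      \<le> (\<integral>\<^sup>+ \<omega>. (\<Sum>n. level_sup l t n \<omega>)\<^sup>2 \<partial>M)"
  proof (intro nn_integral_mono SUP_least)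
    fix s \<omega> assume s: "s \<in> {0..t}"
    have "ennreal ((pairing d l (S s \<omega>))\<^sup>2) = (ennreal \<bar>pairing d l (S s \<omega>)\<bar>)\<^sup>2"
      by (simp add: ennreal_power)
    also have "\<dots> \<le> (\<Sum>n. level_sup l t n \<omega>)\<^sup>2"
      by (intro power_mono order_trans[OF abs_pairing_le_norm_A norm_A_le_suminf_level_sup[OF s]]) simp
    finally show "ennreal ((pairing d l (S s \<omega>))\<^sup>2) \<le> (\<Sum>n. level_sup l t n \<omega>)\<^sup>2" .
  qed
  moreover have "L2_le M (\<lambda>\<omega>. \<Sum>n. level_sup l t n \<omega>) (\<Sum>n. level_norm l t n)"
    by (intro L2_le_suminf L2_le_level_sup t)
  ultimately show ?thesis
    by (auto simp: expectation_le_def L2_le_def)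
qed

text \<open>The pathwise bound by the tail requires the pairing to converge, which happens almost surely;
  so the integrands are compared off a null set.\<close>

lemma integral_SUP_truncation_error_le:
  assumes "0 \<le> T" and l: "(\<Sum>n. level_norm l T n) < \<infinity>"
  shows "expectation_le M
    (\<lambda>\<omega>. SUP t\<in>{0..T}. ennreal \<bar>pairing d l (truncate m (S t \<omega>)) - pairing d l (S t \<omega>)\<bar>)
    (\<Sum>n. level_norm l T (n + m))"
proof -
  have T: "T \<in> {0..T}"
    using assms(1) by simp
  have "(\<lambda>\<omega>. SUP t\<in>{0..T}. ennreal \<bar>pairing d l (truncate m (S t \<omega>)) - pairing d l (S t \<omega>)\<bar>)
    \<in> borel_measurable M"
  proof (rule borel_measurable_SUP_continuous)
    show "AE \<omega> in M. continuous_on {0..T}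
        (\<lambda>t. pairing d l (truncate m (S t \<omega>)) - pairing d l (S t \<omega>))"
      using AE_pairing_continuous[OF assms] AE_level_continuous[of l]
      by eventually_elim (auto simp: pairing_truncate_finite intro!: continuous_intros)
    show "(\<lambda>\<omega>. pairing d l (truncate m (S t \<omega>)) - pairing d l (S t \<omega>)) \<in> borel_measurable M"
      if "t \<in> {0..T}" for t
      unfolding pairing_truncate_finite
      by (intro borel_measurable_diff borel_measurable_sum level_measurable pairing_measurable that)
  qed
  moreover have "(\<integral>\<^sup>+ \<omega>. (SUP t\<in>{0..T}. ennreal \<bar>pairing d l (truncate m (S t \<omega>)) - pairing d l (S t \<omega>)\<bar>) \<partial>M)
      \<le> (\<integral>\<^sup>+ \<omega>. (\<Sum>n. level_sup l T (n + m) \<omega>) \<partial>M)"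
  proof (rule nn_integral_mono_AE)
    show "AE \<omega> in M. (SUP t\<in>{0..T}. ennreal \<bar>pairing d l (truncate m (S t \<omega>)) - pairing d l (S t \<omega>)\<bar>)
        \<le> (\<Sum>n. level_sup l T (n + m) \<omega>)"
      using AE_suminf_level_sup_finite[OF assms]
    proof eventually_elim
      case (elim \<omega>)
      show ?case
      proof (rule SUP_least)
        fix t assume t: "t \<in> {0..T}"
        have "ennreal \<bar>pairing d l (truncate m (S t \<omega>)) - pairing d l (S t \<omega>)\<bar>
            \<le> (\<Sum>n. ennreal \<bar>level d l (n + m) (S t \<omega>)\<bar>)"
          using norm_A_le_suminf_level_sup[OF t] elim
          by (intro pairing_truncate_diff_le) (rule order.strict_trans1)
        also have "\<dots> \<le> (\<Sum>n. level_sup l T (n + m) \<omega>)"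
          by (intro suminf_le level_le_level_sup t) auto
        finally show "ennreal \<bar>pairing d l (truncate m (S t \<omega>)) - pairing d l (S t \<omega>)\<bar>
            \<le> (\<Sum>n. level_sup l T (n + m) \<omega>)" .
      qed
    qed
  qed
  moreover have "\<dots> \<le> (\<Sum>n. level_norm l T (n + m))"
    by (intro L2_le_integral L2_le_suminf L2_le_level_sup T)
  ultimately show ?thesis
    by (auto simp: expectation_le_def)
qed

lemma AE_norm_A_finite:
  assumes "0 \<le> T" "(\<Sum>n. level_norm l T n) < \<infinity>"
  shows "AE \<omega> in M. \<forall>t\<in>{0..T}. norm_A d l (S t \<omega>) < \<infinity>"
  using AE_suminf_level_sup_finite[OF assms]
  by eventually_elim (auto intro: order.strict_trans1[OF norm_A_le_suminf_level_sup])

end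

lemma h_nonneg: "0 \<le> C \<Longrightarrow> 0 \<le> t \<Longrightarrow> 0 \<le> h C t v"
  by (simp add: h_def Let_def)

theorem proposition3p6:
  fixes M :: "'w measure" and F :: "real \<Rightarrow> 'w measure" and T C :: real and d :: nat
    and W :: "nat \<Rightarrow> real \<Rightarrow> 'w \<Rightarrow> real" and S :: "real \<Rightarrow> 'w \<Rightarrow> nat list \<Rightarrow> real"
    and l :: "nat list \<Rightarrow> real"
  assumes "d \<ge> 2" and "T > 0"
    and "usual_conditions M F T"
    and "brownian_motion M F T d W"
    and "is_signature M F T d W S"
    and "C \<ge> 2"
    and "\<And>v t. v \<in> lists {1..d} \<Longrightarrow> t \<in> {0..T} \<Longrightarrow>
           expectation_le M (\<lambda>\<omega>. SUP s\<in>{0..t}. ennreal (\<bar>S s \<omega> v\<bar>\<^sup>2)) (ennreal ((h C t v)\<^sup>2))"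
    and "l \<in> space_Ah d C T"
  shows
    "(space_Ah d C T \<subseteq> space_A M T d S \<and>
      (\<forall>t\<in>{0..T}. expectation_le M
         (\<lambda>\<omega>. SUP s\<in>{0..t}. norm_A d l (S s \<omega>)) (norm_Ah d C t l))) \<and>
     (\<forall>t\<in>{0..T}. expectation_le M
         (\<lambda>\<omega>. SUP s\<in>{0..t}. ennreal ((pairing d l (S s \<omega>))\<^sup>2)) ((norm_Ah d C t l)\<^sup>2)) \<and>
     ((AE \<omega> in M. continuous_on {0..T} (\<lambda>t. pairing d l (S t \<omega>))) \<and>
      (\<forall>m. expectation_le M
         (\<lambda>\<omega>. SUP t\<in>{0..T}. ennreal \<bar>pairing d l (truncate m (S t \<omega>)) - pairing d l (S t \<omega>)\<bar>)
         (\<Sum>n. ennreal (\<Sum>v\<in>words d (n + m). \<bar>l v\<bar> * h C T v))))"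
proof -
  interpret usual_conditions M F T
    by fact
  have S: "continuous_adapted M F T (\<lambda>t \<omega>. S t \<omega> v)" if "v \<in> lists {1..d}" for v
    using \<open>is_signature M F T d W S\<close> that by (auto simp: is_signature_def)
  interpret dominated_coefficients M T d S "h C"
  proof
    fix v :: "nat list" and t :: real
    assume t: "t \<in> {0..T}"
    show "0 \<le> h C t v"
      using \<open>C \<ge> 2\<close> t by (intro h_nonneg) auto
    assume v: "v \<in> lists {1..d}"
    show "(\<lambda>\<omega>. S t \<omega> v) \<in> borel_measurable M"
      using S[OF v] t subalgebra_F[OF t]
      by (auto simp: continuous_adapted_def intro: measurable_from_subalg)
    show "(\<integral>\<^sup>+ \<omega>. (SUP s\<in>{0..t}. ennreal (\<bar>S s \<omega> v\<bar>\<^sup>2)) \<partial>M) \<le> ennreal ((h C t v)\<^sup>2)"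
      using assms(7)[OF v t] by (simp add: expectation_le_def)
  next
    fix v :: "nat list" assume v: "v \<in> lists {1..d}"
    show "AE \<omega> in M. continuous_on {0..T} (\<lambda>t. S t \<omega> v)"
      using S[OF v] by (simp add: continuous_adapted_def)
  qed
  have norm_Ah_eq: "norm_Ah d C t k = (\<Sum>n. level_norm k t n)" for t k
    by (simp add: norm_Ah_def level_norm_def)
  have Ah: "k \<in> space_Ah d C T \<longleftrightarrow> (\<Sum>n. level_norm k T n) < \<infinity>" for k
    by (simp add: space_Ah_def norm_Ah_eq)
  have "0 \<le> T"
    using \<open>T > 0\<close> by simp
  have l: "(\<Sum>n. level_norm l T n) < \<infinity>"
    using \<open>l \<in> space_Ah d C T\<close> by (simp only: Ah)
  have "space_Ah d C T \<subseteq> space_A M T d S"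
    unfolding space_A_def using AE_norm_A_finite[OF \<open>0 \<le> T\<close>] by (auto simp only: Ah)
  moreover have "\<forall>t\<in>{0..T}. expectation_le M
      (\<lambda>\<omega>. SUP s\<in>{0..t}. norm_A d l (S s \<omega>)) (norm_Ah d C t l)"
    unfolding norm_Ah_eq using integral_SUP_norm_A_le by blast
  moreover have "\<forall>t\<in>{0..T}. expectation_le M
      (\<lambda>\<omega>. SUP s\<in>{0..t}. ennreal ((pairing d l (S s \<omega>))\<^sup>2)) ((norm_Ah d C t l)\<^sup>2)"
    unfolding norm_Ah_eq using integral_SUP_pairing_power2_le[OF _ l] by blast
  moreover note AE_pairing_continuous[OF \<open>0 \<le> T\<close> l]
  moreover have "\<forall>m. expectation_le M
      (\<lambda>\<omega>. SUP t\<in>{0..T}. ennreal \<bar>pairing d l (truncate m (S t \<omega>)) - pairing d l (S t \<omega>)\<bar>)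
      (\<Sum>n. ennreal (\<Sum>v\<in>words d (n + m). \<bar>l v\<bar> * h C T v))"
    using integral_SUP_truncation_error_le[OF \<open>0 \<le> T\<close> l] unfolding level_norm_def by (rule allI)
  ultimately show ?thesis
    by (intro conjI)
qed

end
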